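(* Let $T:M\to M$ be a piecewise continuous map with discontinuity set $H$. If $H$ does not contain any nonwandering points of $T$, then $T$ admits a $T$-invariant Borel probability measure.
   Context: $M$ is a $d$-dimensional compact Riemannian manifold with distance $\mathrm{dist}$, or a bounded subset of $\mathbb{R}^d$, that is represented as a finite union of closures of pairwise disjoint domains $M_1,\ldots,M_n$. A map $T:M\to M$ is piecewise continuous (with respect to this partition) if all restrictions $T|_{M_j}$ are continuous. The (compact) discontinuity set is $H=\bigcup_{j=1}^n\partial M_j$. A point $x\in M$ is nonwandering with respect to $T$ if for any neighbourhood $U$ of $x$ there are a point $p\in U$ and a number $k\in\mathbb{N}$ ($k\ge1$) such that $p,T^k(p)\in U$. A Borel probability measure $\mu$ is $T$-invariant if $\mu(T^{-1}(A))=\mu(A)$ for every measurable set $A$. *)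

theory Defs
  imports "HOL-Probability.Probability"
begin

section \<open>Compact Riemannian manifolds\<close>

text \<open>\<open>Ck_on k S f\<close>: all iterated directional derivatives of \<open>f\<close> up to order \<open>k\<close> exist and are
  continuous on \<open>S\<close>. Meant for open \<open>S\<close>.\<close>

primrec Ck_on ::
  "nat \<Rightarrow> 'e::euclidean_space set \<Rightarrow> ('e \<Rightarrow> 'f::real_normed_vector) \<Rightarrow> bool" where
  "Ck_on 0 S f \<longleftrightarrow> continuous_on S f"
| "Ck_on (Suc k) S f \<longleftrightarrow>
     (\<exists>f'. (\<forall>x\<in>S. (f has_derivative f' x) (at x)) \<and> (\<forall>v. Ck_on k S (\<lambda>x. f' x v)))"

definition smooth_on :: "'e::euclidean_space set \<Rightarrow> ('e \<Rightarrow> 'f::real_normed_vector) \<Rightarrow> bool" where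
  "smooth_on S f \<longleftrightarrow> (\<forall>k. Ck_on k S f)"

type_synonym ('a, 'e) chart = "'a set \<times> ('a \<Rightarrow> 'e)"

definition transition :: "('a, 'e) chart \<Rightarrow> ('a, 'e) chart \<Rightarrow> 'e \<Rightarrow> 'e" where
  "transition c c' = snd c' \<circ> inv_into (fst c) (snd c)"

definition smooth_atlas :: "'a topology \<Rightarrow> ('a, 'e::euclidean_space) chart set \<Rightarrow> bool" where
  "smooth_atlas X \<A> \<longleftrightarrow>
     (\<forall>(U, \<phi>)\<in>\<A>. openin X U \<and> open (\<phi> ` U) \<and>
        homeomorphic_map (subtopology X U) (top_of_set (\<phi> ` U)) \<phi>) \<and>
     (\<Union>c\<in>\<A>. fst c) = topspace X \<and>
     (\<forall>c\<in>\<A>. \<forall>c'\<in>\<A>. smooth_on (snd c ` (fst c \<inter> fst c')) (transition c c'))"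

text \<open>A Riemannian metric is given by its coordinate expressions: \<open>g c p v w\<close> is the inner product
  of the tangent vectors at \<open>p\<close> whose coordinates in the chart \<open>c\<close> are \<open>v\<close> and \<open>w\<close>. The last
  conjunct is the tensor transformation law.\<close>

definition riemannian_metric ::
  "('a, 'e::euclidean_space) chart set \<Rightarrow> (('a, 'e) chart \<Rightarrow> 'a \<Rightarrow> 'e \<Rightarrow> 'e \<Rightarrow> real) \<Rightarrow> bool" where
  "riemannian_metric \<A> g \<longleftrightarrow>
     (\<forall>c\<in>\<A>. \<forall>p\<in>fst c. bilinear (g c p) \<and> (\<forall>v w. g c p v w = g c p w v) \<and>
        (\<forall>v. v \<noteq> 0 \<longrightarrow> g c p v v > 0)) \<and>
     (\<forall>c\<in>\<A>. \<forall>v w. smooth_on (snd c ` fst c) (\<lambda>x. g c (inv_into (fst c) (snd c) x) v w)) \<and>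
     (\<forall>c\<in>\<A>. \<forall>c'\<in>\<A>. \<forall>p\<in>fst c \<inter> fst c'. \<forall>v w.
        g c p v w =
        g c' p (frechet_derivative (transition c c') (at (snd c p)) v)
               (frechet_derivative (transition c c') (at (snd c p)) w))"

definition C1_curve ::
  "'a topology \<Rightarrow> ('a, 'e::euclidean_space) chart set \<Rightarrow> (real \<Rightarrow> 'a) \<Rightarrow> real \<Rightarrow> real \<Rightarrow> bool" where
  "C1_curve X \<A> \<gamma> a b \<longleftrightarrow>
     continuous_map (top_of_set {a..b}) X \<gamma> \<and>
     (\<forall>(U, \<phi>)\<in>\<A>.
        (\<forall>t\<in>{a..b} \<inter> \<gamma> -` U. (\<phi> \<circ> \<gamma>) differentiable (at t within {a..b})) \<and>
        continuous_on ({a..b} \<inter> \<gamma> -` U)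
          (\<lambda>t. vector_derivative (\<phi> \<circ> \<gamma>) (at t within {a..b})))"

text \<open>The speed does not depend on the chart chosen around \<open>\<gamma> t\<close>, by the transformation law.\<close>

definition speed ::
  "('a, 'e::euclidean_space) chart set \<Rightarrow> (('a, 'e) chart \<Rightarrow> 'a \<Rightarrow> 'e \<Rightarrow> 'e \<Rightarrow> real) \<Rightarrow>
     (real \<Rightarrow> 'a) \<Rightarrow> real \<Rightarrow> real \<Rightarrow> real \<Rightarrow> real" where
  "speed \<A> g \<gamma> a b t =
     (let c = (SOME c. c \<in> \<A> \<and> \<gamma> t \<in> fst c);
          v = vector_derivative (snd c \<circ> \<gamma>) (at t within {a..b})
      in sqrt (g c (\<gamma> t) v v))"

text \<open>Lengths of the piecewise \<open>C\<^sup>1\<close> curves \<open>\<gamma>\<close> on \<open>[0,1]\<close> from \<open>x\<close> to \<open>y\<close>; the curve is \<open>C\<^sup>1\<close> on each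
  closed interval of the subdivision \<open>\<tau> 0 < \<dots> < \<tau> k\<close>.\<close>

definition curve_lengths ::
  "'a topology \<Rightarrow> ('a, 'e::euclidean_space) chart set \<Rightarrow>
     (('a, 'e) chart \<Rightarrow> 'a \<Rightarrow> 'e \<Rightarrow> 'e \<Rightarrow> real) \<Rightarrow> 'a \<Rightarrow> 'a \<Rightarrow> real set" where
  "curve_lengths X \<A> g x y =
     {(\<Sum>i<k. integral {\<tau> i..\<tau> (Suc i)} (speed \<A> g \<gamma> (\<tau> i) (\<tau> (Suc i)))) | \<gamma> k \<tau>.
        \<gamma> 0 = x \<and> \<gamma> 1 = y \<and> \<tau> 0 = 0 \<and> \<tau> k = 1 \<and>
        (\<forall>i<k. \<tau> i < \<tau> (Suc i) \<and> C1_curve X \<A> \<gamma> (\<tau> i) (\<tau> (Suc i)))}"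

text \<open>\<open>d\<close> is the Riemannian distance and induces the manifold topology. The manifold need not be
  connected: for points in different components, which no curve joins, \<open>d\<close> is only required to
  be a metric compatible with the topology.\<close>

locale compact_riemannian_manifold = Metric_space M d
  for M :: "'a set" and d :: "'a \<Rightarrow> 'a \<Rightarrow> real" +
  fixes \<A> :: "('a, 'e::euclidean_space) chart set"
    and g :: "('a, 'e) chart \<Rightarrow> 'a \<Rightarrow> 'e \<Rightarrow> 'e \<Rightarrow> real"
  assumes compact: "compact_space mtopology"
    and atlas: "smooth_atlas mtopology \<A>"
    and metric: "riemannian_metric \<A> g"
    and distance: "\<And>x y. \<lbrakk>x \<in> M; y \<in> M; curve_lengths mtopology \<A> g x y \<noteq> {}\<rbrakk> \<Longrightarrow>
                     d x y = Inf (curve_lengths mtopology \<A> g x y)"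


section \<open>Piecewise continuous maps\<close>

text \<open>Below, \<open>X\<close> is the ambient topology of the phase space \<open>M\<close>: the topology of the manifold \<open>M\<close>
  itself, or that of the Euclidean space containing \<open>M\<close>. Closures and boundaries of the
  domains \<open>D 1, \<dots>, D n\<close> are taken in \<open>X\<close>.\<close>

definition is_domain :: "'a topology \<Rightarrow> 'a set \<Rightarrow> bool" where
  "is_domain X D \<longleftrightarrow> D \<noteq> {} \<and> openin X D \<and> connectedin X D"

definition domain_decomposition :: "'a topology \<Rightarrow> 'a set \<Rightarrow> nat \<Rightarrow> (nat \<Rightarrow> 'a set) \<Rightarrow> bool" where
  "domain_decomposition X M n D \<longleftrightarrow>
     n \<ge> 1 \<and> (\<forall>j\<in>{1..n}. is_domain X (D j)) \<and> disjoint_family_on D {1..n} \<and>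
     M = (\<Union>j\<in>{1..n}. X closure_of D j)"

definition piecewise_continuous ::
  "'a topology \<Rightarrow> 'a set \<Rightarrow> nat \<Rightarrow> (nat \<Rightarrow> 'a set) \<Rightarrow> ('a \<Rightarrow> 'a) \<Rightarrow> bool" where
  "piecewise_continuous X M n D T \<longleftrightarrow>
     T \<in> M \<rightarrow> M \<and>
     (\<forall>j\<in>{1..n}. continuous_map (subtopology X (D j)) (subtopology X M) T)"

definition discontinuity_set :: "'a topology \<Rightarrow> nat \<Rightarrow> (nat \<Rightarrow> 'a set) \<Rightarrow> 'a set" where
  "discontinuity_set X n D = (\<Union>j\<in>{1..n}. X frontier_of D j)"

definition nonwandering :: "'a topology \<Rightarrow> 'a set \<Rightarrow> ('a \<Rightarrow> 'a) \<Rightarrow> 'a \<Rightarrow> bool" where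
  "nonwandering X M T x \<longleftrightarrow>
     x \<in> M \<and>
     (\<forall>U. openin (subtopology X M) U \<and> x \<in> U \<longrightarrow> (\<exists>p\<in>U. \<exists>k\<ge>1. (T ^^ k) p \<in> U))"

definition borel_on :: "'a topology \<Rightarrow> 'a set \<Rightarrow> 'a measure" where
  "borel_on X M = sigma M {U. openin (subtopology X M) U}"

text \<open>A piecewise continuous map is arbitrary on the discontinuity set, so the preimage of a Borel
  set need not be Borel. Invariance therefore demands that preimages of Borel sets are
  \<open>\<mu>\<close>-measurable and measures them with the completion of \<open>\<mu>\<close>.\<close>

definition invariant_borel_probability ::
  "'a topology \<Rightarrow> 'a set \<Rightarrow> ('a \<Rightarrow> 'a) \<Rightarrow> 'a measure \<Rightarrow> bool" where
  "invariant_borel_probability X M T \<mu> \<longleftrightarrow>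
     prob_space \<mu> \<and> space \<mu> = M \<and> sets \<mu> = sets (borel_on X M) \<and>
     (\<forall>A\<in>sets \<mu>. T -` A \<inter> M \<in> sets (completion \<mu>) \<and>
        emeasure (completion \<mu>) (T -` A \<inter> M) = emeasure \<mu> A)"

text \<open>For Borel maps this is the usual notion.\<close>

lemma invariant_borel_probability_iff:
  assumes "T \<in> measurable (borel_on X M) (borel_on X M)"
  shows "invariant_borel_probability X M T \<mu> \<longleftrightarrow>
     prob_space \<mu> \<and> space \<mu> = M \<and> sets \<mu> = sets (borel_on X M) \<and>
     (\<forall>A\<in>sets \<mu>. emeasure \<mu> (T -` A \<inter> M) = emeasure \<mu> A)"
proof -
  have sp: "space (borel_on X M) = M"
    unfolding borel_on_def by (rule space_measure_of) (auto simp: openin_subtopology)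
  have "T -` A \<inter> M \<in> sets \<mu>" if "sets \<mu> = sets (borel_on X M)" "A \<in> sets \<mu>" for A
    using measurable_sets[OF assms(1), of A] that sp by simp
  then show ?thesis
    unfolding invariant_borel_probability_def by auto
qed

end

theory Submission
  imports Defs
begin

text \<open>Each point of \<open>H\<close> has an open neighbourhood that no orbit visits twice. Finitely many of them
  cover \<open>H\<close>, so every orbit eventually stays in the compact complement \<open>K\<close> of their union \<open>U\<close>, where
  \<open>T\<close> is continuous. The points whose whole forward orbit lies in \<open>K\<close> form a nonempty closed set \<open>Y\<close>
  with \<open>T Y \<subseteq> Y\<close>, and the Krylov--Bogolyubov theorem applies to \<open>T\<close> on \<open>Y\<close>. Instead of going
  through the Riesz representation theorem, the latter takes a finitely additive invariant
  mean on all subsets and regularises it to a Borel measure by compact sets from inside and open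
  sets from outside.\<close>

subsection \<open>An invariant mean along an orbit\<close>

text \<open>\<open>m A\<close> is a generalised limit of the frequencies of visits of \<open>s\<close> to \<open>A\<close>, obtained as a cluster
  point in the compact space of all functions from sets to \<open>[0,1]\<close>.\<close>

lemma obtain_invariant_mean:
  fixes s :: "nat \<Rightarrow> 'a"
  obtains m :: "'a set \<Rightarrow> real" where
    "\<And>A. 0 \<le> m A"
    "\<And>A. range s \<subseteq> A \<Longrightarrow> m A = 1"
    "\<And>A B. A \<inter> B = {} \<Longrightarrow> m (A \<union> B) = m A + m B"
    "\<And>A B. (\<And>k. s (Suc k) \<in> A \<longleftrightarrow> s k \<in> B) \<Longrightarrow> m A = m B"
proof -
  \<comment> \<open>At \<open>n = 0\<close> division by zero gives the value 0, so the bounds that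
    follow hold for every \<open>n\<close>.\<close>
  define avg :: "nat \<Rightarrow> 'a set \<Rightarrow> real" where "avg n A = (\<Sum>k<n. indicator A (s k)) / n" for n A
  have avg_bounds: "avg n A \<in> {0..1}" for n A
  proof -
    have "(\<Sum>k<n. indicator A (s k) :: real) \<le> (\<Sum>k<n. 1)"
      by (intro sum_mono) (auto simp: indicator_def)
    then show ?thesis
      by (auto simp: avg_def divide_le_eq intro!: sum_nonneg divide_nonneg_nonneg)
  qed
  \<comment> \<open>Tychonoff: the functions with values in [0,1] form a compact set for pointwise
    convergence, so the averages have a cluster point \<open>m\<close>.\<close>
  have "compactin (product_topology (\<lambda>i::'a set. euclidean) UNIV) (PiE UNIV (\<lambda>_. {0..1::real}))"
    by (simp add: compactin_PiE)
  then have "compact (PiE (UNIV :: 'a set set) (\<lambda>_. {0..1::real}))"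
    by (simp add: euclidean_product_topology)
  moreover have "eventually (\<lambda>f. f \<in> PiE UNIV (\<lambda>_. {0..1::real})) (filtermap avg sequentially)"
    using avg_bounds by (simp add: eventually_filtermap PiE_UNIV_domain del: atLeastAtMost_iff)
  ultimately obtain m where m: "inf (nhds m) (filtermap avg sequentially) \<noteq> bot"
    unfolding compact_filter by (metis filtermap_bot_iff sequentially_bot)
  \<comment> \<open>In a large product a cluster point need not be the limit of a subsequence. The
    filter \<open>G\<close> on the indices takes the place of a subnet: it refines
    \<open>sequentially\<close>, and \<open>avg\<close> tends to \<open>m\<close> along it.\<close>
  define G where "G = inf (filtercomap avg (nhds m)) sequentially"
  have G: "G \<noteq> bot"
  proof
    assume "G = bot"
    then have "eventually (\<lambda>_. False) G" by simp
    then obtain P Q where PQ: "eventually P (nhds m)" "eventually Q sequentially" "\<And>n. P (avg n) \<Longrightarrow> Q n \<Longrightarrow> False"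
      unfolding G_def eventually_inf eventually_filtercomap by blast
    have "eventually (\<lambda>f. \<not> P f) (filtermap avg sequentially)"
      unfolding eventually_filtermap using PQ(2) by eventually_elim (use PQ(3) in blast)
    with PQ(1) have "eventually (\<lambda>_. False) (inf (nhds m) (filtermap avg sequentially))"
      unfolding eventually_inf by blast
    with m show False by (simp add: trivial_limit_def)
  qed
  have G_seq: "G \<le> sequentially"
    by (simp add: G_def)
  have lim: "((\<lambda>n. avg n A) \<longlongrightarrow> m A) G" for A
  proof -
    have "((\<lambda>f. f A) \<longlongrightarrow> m A) (nhds m)"
    proof (rule topological_tendstoI)
      fix S :: "real set" assume "open S" "m A \<in> S"
      then show "eventually (\<lambda>f. f A \<in> S) (nhds m)"
        using open_vimage[OF _ continuous_on_product_coordinates[of A]]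
        by (auto simp: eventually_nhds vimage_def)
    qed
    moreover have "filterlim avg (nhds m) G"
      by (simp add: filterlim_iff_le_filtercomap G_def)
    ultimately show ?thesis
      by (rule filterlim_compose)
  qed
  show thesis
  proof
    show "0 \<le> m A" for A
      using lim by (rule tendsto_lowerbound) (use avg_bounds G in auto)
    show "m A = 1" if "range s \<subseteq> A" for A
    proof -
      have "s k \<in> A" for k
        using that by blast
      then have "avg n A = 1" if "n > 0" for n
        using that by (simp add: avg_def)
      then have "eventually (\<lambda>n. avg n A = 1) sequentially"
        by (intro eventually_mono[OF eventually_gt_at_top[of 0]])
      then have "((\<lambda>n. avg n A) \<longlongrightarrow> 1) G"
        by (intro tendsto_eventually filter_leD[OF G_seq])
      then show ?thesis using tendsto_unique[OF G lim] by blast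
    qed
    show "m (A \<union> B) = m A + m B" if "A \<inter> B = {}" for A B
    proof -
      have "avg n (A \<union> B) = avg n A + avg n B" for n
        using that by (simp add: avg_def indicator_add[symmetric] sum.distrib add_divide_distrib)
      then have "((\<lambda>n. avg n (A \<union> B)) \<longlongrightarrow> m A + m B) G"
        using tendsto_add[OF lim lim] by simp
      then show ?thesis using tendsto_unique[OF G lim] by blast
    qed
    show "m A = m B" if shift: "\<And>k. s (Suc k) \<in> A \<longleftrightarrow> s k \<in> B" for A B
    proof -
      \<comment> \<open>Passing from \<open>A\<close> to \<open>B\<close> shifts the orbit by one
        step, so the difference telescopes to the two end terms and is at most \<open>1 / n\<close>
        in absolute value.\<close>
      have "avg n B - avg n A = (indicator A (s n) - indicator A (s 0)) / n" for n
      proof -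
        have "avg n B - avg n A = (\<Sum>k<n. indicator A (s (Suc k)) - indicator A (s k)) / n"
          by (simp add: avg_def shift indicator_def sum_subtractf diff_divide_distrib)
        then show ?thesis using sum_lessThan_telescope[of "\<lambda>k. indicator A (s k) :: real" n] by simp
      qed
      then have "\<bar>avg n B - avg n A\<bar> \<le> 1 / n" for n
        by (auto simp: indicator_def)
      then have "((\<lambda>n. avg n B - avg n A) \<longlongrightarrow> 0) sequentially"
        by (intro tendsto_rabs_zero_cancel[OF tendsto_sandwich[OF _ _ tendsto_const lim_1_over_n]]) auto
      then have "((\<lambda>n. avg n B - avg n A) \<longlongrightarrow> 0) G"
        by (rule tendsto_mono[OF G_seq])
      moreover have "((\<lambda>n. avg n B - avg n A) \<longlongrightarrow> m B - m A) G"
        by (intro tendsto_diff lim)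
      ultimately have "m B - m A = 0"
        using tendsto_unique[OF G] by blast
      then show ?thesis by simp
    qed
  qed
qed

subsection \<open>Borel measures from finitely additive set functions\<close>

lemma space_borel_on [simp]: "space (borel_on X M) = M"
  unfolding borel_on_def by (rule space_measure_of) (auto simp: openin_subtopology)

lemma sets_borel_on_topspace: "sets (borel_on X (topspace X)) = sigma_sets (topspace X) {U. openin X U}"
  unfolding borel_on_def by (subst sets_measure_of) (auto dest: openin_subset)

text \<open>\<open>m\<close> need not be countably additive, so a Caratheodory construction starts
  from its values on closed sets. Normality gives finite subadditivity on open sets, compactness
  makes it countable, and additivity of \<open>m\<close> on disjoint closed sets makes open sets
  measurable. The formula for open sets later carries invariance from \<open>m\<close> to
  \<open>\<mu>\<close>.\<close>

lemma obtain_borel_measure_from_content: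
  fixes m :: "'a set \<Rightarrow> real"
  assumes "compact_space X" "normal_space X"
    and nonneg: "\<And>A. 0 \<le> m A"
    and add: "\<And>A B. A \<inter> B = {} \<Longrightarrow> m (A \<union> B) = m A + m B"
    and total: "m (topspace X) = 1"
  obtains \<mu> where "prob_space \<mu>" "space \<mu> = topspace X" "sets \<mu> = sets (borel_on X (topspace X))"
    "\<And>U. openin X U \<Longrightarrow> emeasure \<mu> U = (SUP C\<in>{C. closedin X C \<and> C \<subseteq> U}. ennreal (m C))"
proof -
  \<comment> \<open>As in the proof of the Riesz representation theorem, \<open>inner\<close>
    prescribes the measure of open sets, and \<open>outer\<close> extends it to arbitrary sets from
    above.\<close>
  define inner where "inner U = (SUP C\<in>{C. closedin X C \<and> C \<subseteq> U}. ennreal (m C))" for U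
  define outer where "outer A = (INF U\<in>{U. openin X U \<and> A \<subseteq> U}. inner U)" for A
  have m_mono: "m A \<le> m B" if "A \<subseteq> B" for A B
    using add[of A "B - A"] nonneg[of "B - A"] that by (simp add: Un_absorb1)
  have m_subadd: "m (A \<union> B) \<le> m A + m B" for A B
    using add[of A "B - A"] m_mono[of "B - A" B] by simp
  have m_empty: "m {} = 0"
    using add[of "{}" "{}"] by simp
  have inner_ge: "ennreal (m C) \<le> inner U" if "closedin X C" "C \<subseteq> U" for C U
    unfolding inner_def using that by (intro SUP_upper) auto
  have inner_mono: "inner U \<le> inner V" if "U \<subseteq> V" for U V
    unfolding inner_def using that by (intro SUP_subset_mono) auto
  have outer_le: "outer A \<le> inner U" if "openin X U" "A \<subseteq> U" for A U
    unfolding outer_def using that by (intro INF_lower) auto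
  have outer_open: "outer U = inner U" if "openin X U" for U
    using that unfolding outer_def by (intro antisym INF_lower INF_greatest inner_mono) auto
  \<comment> \<open>Normality separates the part of \<open>C\<close> outside the first
    \<open>n\<close> sets from the part outside \<open>U n\<close>. Removing the separating sets
    \<open>P\<close> and \<open>Q\<close> leaves two closed pieces that cover \<open>C\<close>: one
    is covered by the first \<open>n\<close> sets, the other lies in \<open>U n\<close>.\<close>
  have m_cover: "ennreal (m C) \<le> (\<Sum>i<n. inner (U i))"
    if "closedin X C" "\<And>i. openin X (U i)" "C \<subseteq> (\<Union>i<n. U i)" for C n and U :: "nat \<Rightarrow> 'a set"
    using that
  proof (induction n arbitrary: C)
    case 0
    then show ?case by (simp add: m_empty)
  next
    case (Suc n)
    have "closedin X (C - (\<Union>i<n. U i))" "closedin X (C - U n)"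
      using Suc.prems by (auto intro!: closedin_diff)
    moreover have "disjnt (C - (\<Union>i<n. U i)) (C - U n)"
      using Suc.prems(3) by (auto simp: disjnt_def lessThan_Suc)
    ultimately obtain P Q where PQ: "openin X P" "openin X Q" "C - (\<Union>i<n. U i) \<subseteq> P" "C - U n \<subseteq> Q" "disjnt P Q"
      using \<open>normal_space X\<close> unfolding normal_space_def by meson
    have "ennreal (m C) \<le> ennreal (m (C - P) + m (C - Q))"
      using m_subadd[of "C - P" "C - Q"] \<open>disjnt P Q\<close>
      by (intro ennreal_leI) (simp add: Un_Diff_Int Diff_Int[symmetric] disjnt_def)
    also have "\<dots> = ennreal (m (C - P)) + ennreal (m (C - Q))"
      by (simp add: nonneg)
    also have "\<dots> \<le> (\<Sum>i<n. inner (U i)) + inner (U n)"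
      using PQ Suc.prems by (intro add_mono Suc.IH inner_ge closedin_diff) auto
    finally show ?case by simp
  qed
  have inner_UN: "inner (\<Union>i. U i) \<le> (\<Sum>i. inner (U i))" if U: "\<And>i. openin X (U i)" for U :: "nat \<Rightarrow> 'a set"
    unfolding inner_def[of "\<Union>i. U i"]
  proof (rule SUP_least)
    fix C assume C: "C \<in> {C. closedin X C \<and> C \<subseteq> (\<Union>i. U i)}"
    then have "compactin X C"
      using \<open>compact_space X\<close> closedin_compact_space by blast
    then obtain I where "finite I" "C \<subseteq> (\<Union>i\<in>I. U i)"
    proof -
      have "\<exists>\<F>. finite \<F> \<and> \<F> \<subseteq> range U \<and> C \<subseteq> \<Union>\<F>"
        using \<open>compactin X C\<close> C U unfolding compactin_def by auto
      then show thesis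
        using that by (metis finite_subset_image)
    qed
    \<comment> \<open>For empty \<open>I\<close> the value \<open>Max I\<close> is unspecified, but
      then \<open>C\<close> is empty.\<close>
    then have "C \<subseteq> (\<Union>i<Suc (Max I). U i)"
      by (force simp: less_Suc_eq_le)
    then have "ennreal (m C) \<le> (\<Sum>i<Suc (Max I). inner (U i))"
      using C U by (intro m_cover) auto
    also have "\<dots> \<le> (\<Sum>i. inner (U i))"
      by (intro sum_le_suminf) auto
    finally show "ennreal (m C) \<le> (\<Sum>i. inner (U i))" .
  qed
  have inner_top: "inner (topspace X) = 1"
  proof (rule antisym)
    show "inner (topspace X) \<le> 1"
      unfolding inner_def using m_mono[of _ "topspace X"] total by (auto intro!: SUP_least ennreal_le_1[THEN iffD2])
    show "1 \<le> inner (topspace X)"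
      using inner_ge[of "topspace X" "topspace X"] total by simp
  qed
  have oms: "outer_measure_space (Pow (topspace X)) outer"
    unfolding outer_measure_space_def
  proof (intro conjI)
    have "inner {} = 0"
      unfolding inner_def by (auto simp: m_empty intro!: antisym SUP_least)
    then show "positive (Pow (topspace X)) outer"
      by (simp add: positive_def outer_open)
    show "increasing (Pow (topspace X)) outer"
      unfolding increasing_def outer_def by (auto intro!: INF_superset_mono)
    show "countably_subadditive (Pow (topspace X)) outer"
      unfolding countably_subadditive_def
    proof (intro allI impI)
      fix A :: "nat \<Rightarrow> 'a set"
      assume A: "range A \<subseteq> Pow (topspace X)"
      \<comment> \<open>Finiteness makes adding a positive error a strict increase, so some open set
        nearly attains the infimum defining \<open>outer (A i)\<close>.\<close>
      have fin: "outer (A i) < \<infinity>" for i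
        using outer_le[of "topspace X" "A i"] A inner_top
        by (metis PowD ennreal_one_less_top infinity_ennreal_def openin_topspace order_le_less_trans range_subsetD)
      show "outer (\<Union>i. A i) \<le> (\<Sum>i. outer (A i))"
      proof (rule ennreal_le_epsilon)
        fix e :: real assume "0 < e"
        \<comment> \<open>The errors halve from one index to the next and add up to
          \<open>e\<close>.\<close>
        have "\<exists>U. openin X U \<and> A i \<subseteq> U \<and> inner U \<le> outer (A i) + ennreal (e * (1/2) ^ Suc i)" for i
        proof -
          have "outer (A i) < outer (A i) + ennreal (e * (1/2) ^ Suc i)"
            using fin[of i] \<open>0 < e\<close> ennreal_add_left_cancel_less[of "outer (A i)" 0] by simp
          then show ?thesis
            unfolding outer_def[of "A i"] INF_less_iff by (auto intro: less_imp_le)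
        qed
        then obtain U where U: "\<And>i. openin X (U i)" "\<And>i. A i \<subseteq> U i"
          "\<And>i. inner (U i) \<le> outer (A i) + ennreal (e * (1/2) ^ Suc i)"
          by metis
        have "outer (\<Union>i. A i) \<le> inner (\<Union>i. U i)"
          using U by (intro outer_le) auto
        also have "\<dots> \<le> (\<Sum>i. inner (U i))"
          using U by (intro inner_UN)
        also have "\<dots> \<le> (\<Sum>i. outer (A i) + ennreal (e * (1/2) ^ Suc i))"
          using U by (intro suminf_le) auto
        also have "\<dots> = (\<Sum>i. outer (A i)) + (\<Sum>i. ennreal (e * (1/2) ^ Suc i))"
          by (simp add: suminf_add)
        also have "(\<Sum>i. ennreal (e * (1/2) ^ Suc i)) = ennreal e"
          using \<open>0 < e\<close> sums_mult[OF power_half_series, of e]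
          by (intro suminf_ennreal_eq) auto
        finally show "outer (\<Union>i. A i) \<le> (\<Sum>i. outer (A i)) + ennreal e" .
      qed
    qed
  qed
  let ?L = "lambda_system (topspace X) (Pow (topspace X)) outer"
  have L: "measure_space (topspace X) ?L outer"
    by (rule sigma_algebra.caratheodory_lemma[OF sigma_algebra_Pow oms])
  have open_L: "U \<in> ?L" if U: "openin X U" for U
  proof -
    have "outer (A \<inter> U) + outer (A - U) = outer A" if A: "A \<subseteq> topspace X" for A
    proof (rule antisym)
      have "subadditive (Pow (topspace X)) outer"
        using oms unfolding outer_measure_space_def
        by (auto intro: ring_of_sets.countably_subadditive_subadditive[OF ring_of_sets_Pow])
      then have "outer ((A \<inter> U) \<union> (A - U)) \<le> outer (A \<inter> U) + outer (A - U)"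
        using A by (intro subadditiveD) auto
      then show "outer A \<le> outer (A \<inter> U) + outer (A - U)"
        by (simp add: Int_Diff_Un)
      show "outer (A \<inter> U) + outer (A - U) \<le> outer A"
        unfolding outer_def[of A]
      proof (rule INF_greatest, clarify)
        fix V assume V: "openin X V" "A \<subseteq> V"
        \<comment> \<open>Exhaustion in two stages: a closed \<open>C\<close> inside
          \<open>V \<inter> U\<close>, then a closed \<open>E\<close> inside \<open>V - C\<close>.
          The open set \<open>V - C\<close> contains \<open>A - U\<close> because \<open>C\<close>
          lies in \<open>U\<close>, and additivity of \<open>m\<close> applies to the disjoint sets
          \<open>C\<close> and \<open>E\<close> inside \<open>V\<close>.\<close>
        have "inner (V \<inter> U) + outer (A - U) \<le> inner V"
        proof -
          have "inner (V \<inter> U) + outer (A - U) =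
            (SUP C\<in>{C. closedin X C \<and> C \<subseteq> V \<inter> U}. ennreal (m C) + outer (A - U))"
            unfolding inner_def by (intro ennreal_SUP_add_left[symmetric]) blast
          also have "\<dots> \<le> inner V"
          proof (rule SUP_least, clarify)
            fix C assume C: "closedin X C" "C \<subseteq> V \<inter> U"
            have "outer (A - U) \<le> inner (V - C)"
              using C V by (intro outer_le openin_diff) auto
            then have "ennreal (m C) + outer (A - U) \<le> ennreal (m C) + inner (V - C)"
              by (rule add_left_mono)
            also have "\<dots> = (SUP E\<in>{E. closedin X E \<and> E \<subseteq> V - C}. ennreal (m C) + ennreal (m E))"
              unfolding inner_def by (intro ennreal_SUP_add_right) blast
            also have "\<dots> \<le> inner V"
            proof (rule SUP_least, clarify)
              fix E assume E: "closedin X E" "E \<subseteq> V - C"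
              then have "C \<inter> E = {}"
                by blast
              then have "ennreal (m C) + ennreal (m E) = ennreal (m (C \<union> E))"
                by (simp add: add nonneg)
              also have "\<dots> \<le> inner V"
                using C E by (intro inner_ge closedin_Un) auto
              finally show "ennreal (m C) + ennreal (m E) \<le> inner V" .
            qed
            finally show "ennreal (m C) + outer (A - U) \<le> inner V" .
          qed
          finally show ?thesis .
        qed
        moreover have "outer (A \<inter> U) \<le> inner (V \<inter> U)"
          using U V by (intro outer_le openin_Int) auto
        ultimately show "outer (A \<inter> U) + outer (A - U) \<le> inner V"
          by (meson add_right_mono order_trans)
      qed
    qed
    then show ?thesis
      using openin_subset[OF U] by (simp add: algebra.lambda_system_eq[OF algebra_Pow])
  qed
  interpret L: sigma_algebra "topspace X" ?L
    using L by (simp add: measure_space_def)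
  have sub: "sigma_sets (topspace X) {U. openin X U} \<subseteq> ?L"
    using open_L by (intro L.sigma_sets_subset) auto
  \<comment> \<open>All Borel sets lie in the lambda system, where \<open>outer\<close> is countably
    additive.\<close>
  define \<mu> where "\<mu> = measure_of (topspace X) {U. openin X U} outer"
  have em: "emeasure \<mu> U = inner U" if "openin X U" for U
  proof -
    have "emeasure \<mu> U = outer U"
    proof (rule emeasure_measure_of[OF \<mu>_def])
      have "sets \<mu> \<subseteq> ?L"
        using sub unfolding \<mu>_def by (subst sets_measure_of) (auto dest: openin_subset)
      then show "positive (sets \<mu>) outer" "countably_additive (sets \<mu>) outer"
        using L by (auto simp: measure_space_def positive_def countably_additive_def)
    qed (use that openin_subset in \<open>auto simp: \<mu>_def\<close>)
    then show ?thesis using that outer_open by simp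
  qed
  show thesis
  proof
    show sp: "space \<mu> = topspace X"
      unfolding \<mu>_def by (rule space_measure_of) (auto dest: openin_subset)
    show "sets \<mu> = sets (borel_on X (topspace X))"
      unfolding \<mu>_def sets_borel_on_topspace by (rule sets_measure_of) (auto dest: openin_subset)
    show "prob_space \<mu>"
      by (rule prob_spaceI) (simp add: sp em inner_top)
    show "\<And>U. openin X U \<Longrightarrow> emeasure \<mu> U = (SUP C\<in>{C. closedin X C \<and> C \<subseteq> U}. ennreal (m C))"
      using em by (simp add: inner_def)
  qed
qed

subsection \<open>The Krylov--Bogolyubov theorem\<close>

text \<open>Invariance of the content gives \<open>\<mu> U \<le> \<mu> (T\<^sup>-\<^sup>1 U)\<close> for open \<open>U\<close> and hence the reverse inequality for
  closed sets; equality follows since open sets are countable unions of closed ones.\<close>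

lemma krylov_bogolyubov:
  assumes "compact_space X" "metrizable_space X" "topspace X \<noteq> {}" and T: "continuous_map X X T"
  obtains \<mu> where "prob_space \<mu>" "space \<mu> = topspace X" "sets \<mu> = sets (borel_on X (topspace X))"
    "T \<in> measurable \<mu> \<mu>" "distr \<mu> \<mu> T = \<mu>"
proof -
  have T_space: "T x \<in> topspace X" if "x \<in> topspace X" for x
    using T that by (auto simp: continuous_map_def)
  obtain x where x: "x \<in> topspace X"
    using assms(3) by blast
  define s where "s k = (T ^^ k) x" for k
  have s_space: "s k \<in> topspace X" for k
    by (induction k) (use x T_space in \<open>auto simp: s_def\<close>)
  obtain m where m_nonneg: "\<And>A. 0 \<le> m A"
    and m_range: "\<And>A. range s \<subseteq> A \<Longrightarrow> m A = (1::real)"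
    and m_add: "\<And>A B. A \<inter> B = {} \<Longrightarrow> m (A \<union> B) = m A + m B"
    and m_shift: "\<And>A B. (\<And>k. s (Suc k) \<in> A \<longleftrightarrow> s k \<in> B) \<Longrightarrow> m A = m B"
    using obtain_invariant_mean[of s] by metis
  have m_space: "m (topspace X) = 1"
    using s_space by (intro m_range) blast
  obtain \<mu> where \<mu>: "prob_space \<mu>" "space \<mu> = topspace X" "sets \<mu> = sets (borel_on X (topspace X))"
    and em: "\<And>U. openin X U \<Longrightarrow> emeasure \<mu> U = (SUP C\<in>{C. closedin X C \<and> C \<subseteq> U}. ennreal (m C))"
    using obtain_borel_measure_from_content[where m = m and X = X, OF assms(1) metrizable_imp_normal_space[OF assms(2)]
        m_nonneg m_add m_space]
    by metis
  interpret prob_space \<mu> by fact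
  have sets_\<mu>: "sets \<mu> = sigma_sets (topspace X) {U. openin X U}"
    using \<mu>(3) by (simp add: sets_borel_on_topspace)
  have open_sets: "U \<in> sets \<mu>" if "openin X U" for U
    using that by (simp add: sets_\<mu> sigma_sets.Basic)
  have closed_sets: "C \<in> sets \<mu>" if "closedin X C" for C
  proof -
    have "topspace X - (topspace X - C) \<in> sets \<mu>"
      using that open_sets \<mu>(2) by (metis closedin_def sets.compl_sets)
    then show ?thesis
      using closedin_subset[OF that] by (simp add: double_diff)
  qed
  have vimage: "T -` A \<inter> topspace X = {x \<in> topspace X. T x \<in> A}" for A
    by auto
  have meas: "T \<in> measurable \<mu> \<mu>"
  proof (rule measurable_sigma_sets[OF sets_\<mu>])
    show "{U. openin X U} \<subseteq> Pow (topspace X)"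
      by (auto dest: openin_subset)
    show "T \<in> space \<mu> \<rightarrow> topspace X"
      using T_space by (simp add: \<mu>(2))
    show "T -` U \<inter> space \<mu> \<in> sets \<mu>" if "U \<in> {U. openin X U}" for U
      using that openin_continuous_map_preimage[OF T] by (auto simp: \<mu>(2) vimage intro!: open_sets)
  qed
  interpret D: prob_space "distr \<mu> \<mu> T"
    using meas by (rule prob_space_distr)
  have open_le: "emeasure \<mu> U \<le> emeasure (distr \<mu> \<mu> T) U" if U: "openin X U" for U
  proof -
    let ?V = "{x \<in> topspace X. T x \<in> U}"
    have "emeasure \<mu> U \<le> emeasure \<mu> ?V"
      unfolding em[OF U]
    proof (rule SUP_least, clarify)
      fix C assume C: "closedin X C" "C \<subseteq> U"
      \<comment> \<open>The orbit stays in the space, so \<open>s (Suc k)\<close> lies in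
        \<open>C\<close> exactly when \<open>s k\<close> lies in the preimage of \<open>C\<close>.
        This preimage is a closed subset of \<open>?V\<close> and so competes in the supremum for
        \<open>?V\<close>.\<close>
      have "m C = m {x \<in> topspace X. T x \<in> C}"
        using s_space by (intro m_shift) (simp add: s_def)
      also have "ennreal \<dots> \<le> emeasure \<mu> ?V"
        unfolding em[OF openin_continuous_map_preimage[OF T U]]
        using C closedin_continuous_map_preimage[OF T C(1)] by (intro SUP_upper) auto
      finally show "ennreal (m C) \<le> emeasure \<mu> ?V" .
    qed
    then show ?thesis
      using open_sets[OF U] meas by (simp add: emeasure_distr \<mu>(2) vimage)
  qed
  have closed_le: "emeasure (distr \<mu> \<mu> T) C \<le> emeasure \<mu> C" if C: "closedin X C" for C
  proof -
    have "openin X (topspace X - C)"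
      using C by blast
    \<comment> \<open>Both measures have total mass 1, so taking complements reverses the
      inequality.\<close>
    from open_le[OF this] have "prob (topspace X - C) \<le> D.prob (topspace X - C)"
      by (simp add: emeasure_eq_measure D.emeasure_eq_measure)
    then have "D.prob C \<le> prob C"
      using prob_compl[OF closed_sets[OF C]] D.prob_compl[of C] closed_sets[OF C] by (simp add: \<mu>(2))
    then show ?thesis
      by (simp add: emeasure_eq_measure D.emeasure_eq_measure)
  qed
  have "emeasure (distr \<mu> \<mu> T) U = emeasure \<mu> U" if U: "openin X U" for U
  proof (rule antisym)
    obtain C :: "nat \<Rightarrow> 'a set" where C: "\<And>n. closedin X (C n)" "\<And>n. C n \<subseteq> C (Suc n)" "(\<Union>n. C n) = U"
      using open_imp_fsigma_in[OF assms(2) U] unfolding fsigma_in_ascending by metis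
    have "emeasure (distr \<mu> \<mu> T) U = (SUP n. emeasure (distr \<mu> \<mu> T) (C n))"
      using C closed_sets by (subst SUP_emeasure_incseq) (auto intro: incseq_SucI)
    also have "\<dots> \<le> emeasure \<mu> U"
      using C closed_le open_sets[OF U]
      by (intro SUP_least order_trans[OF closed_le] emeasure_mono) auto
    finally show "emeasure (distr \<mu> \<mu> T) U \<le> emeasure \<mu> U" .
  qed (rule open_le[OF U])
  then have "distr \<mu> \<mu> T = \<mu>"
    by (intro measure_eqI_generator_eq[where \<Omega> = "topspace X" and E = "{U. openin X U}" and A = "\<lambda>_. topspace X"])
      (auto simp: sets_\<mu> Int_stable_def dest: openin_subset)
  with that \<mu> meas show thesis by blast
qed

subsection \<open>Maps with wandering discontinuities\<close>

text \<open>A closed \<open>Y\<close> is itself Borel, so traces of Borel sets on it are Borel in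
  \<open>X\<close>; the relatively open sets generating the Borel sets of \<open>Y\<close> are such
  traces.\<close>

lemma sets_borel_on_closed_subspace:
  assumes "closedin X Y" and A: "A \<in> sets (borel_on (subtopology X Y) Y)"
  shows "A \<in> sets (borel_on X (topspace X))"
proof -
  have Y: "Y \<subseteq> topspace X"
    using assms(1) by (rule closedin_subset)
  let ?B = "borel_on X (topspace X)"
  have "topspace X - Y \<in> sets ?B"
    using assms(1) by (auto simp: sets_borel_on_topspace closedin_def intro: sigma_sets.Basic)
  from sets.compl_sets[OF this] have Y_sets: "Y \<in> sets ?B"
    using Y by (simp add: double_diff)
  have "A \<in> sigma_sets Y {U. openin (subtopology X Y) U}"
    using A Y sets_borel_on_topspace[of "subtopology X Y"] by (simp add: Int_absorb1)
  also have "\<dots> \<subseteq> sets (restrict_space ?B Y)"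
  proof -
    have "{U. openin (subtopology X Y) U} \<subseteq> sets (restrict_space ?B Y)"
      using Y Y_sets
      by (auto simp: openin_subtopology sets_restrict_space sets_borel_on_topspace intro!: sigma_sets.Basic)
    then show ?thesis
      using sets.sigma_sets_subset[of _ "restrict_space ?B Y"] Y by (simp add: space_restrict_space Int_absorb2)
  qed
  finally show ?thesis
    using Y_sets Y by (simp add: sets_restrict_space_iff Int_absorb2)
qed

text \<open>An orbit meeting a wandering neighbourhood at times \<open>i < j\<close> would
  contradict its choice with \<open>k = j - i\<close>. Each member of a finite subcover is therefore
  visited at most once, and the orbit leaves the union for good, after a time that depends on the
  starting point.\<close>

lemma orbit_eventually_avoids:
  assumes "compactin X H" and "\<And>x. x \<in> H \<Longrightarrow> \<not> nonwandering X (topspace X) T x"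
  obtains U where "openin X U" "H \<subseteq> U" "\<And>x. \<exists>N. \<forall>n\<ge>N. (T ^^ n) x \<notin> U"
proof -
  define wandering where "wandering U \<longleftrightarrow> openin X U \<and> (\<forall>p\<in>U. \<forall>k\<ge>1. (T ^^ k) p \<notin> U)" for U
  have "\<exists>U. wandering U \<and> x \<in> U" if "x \<in> H" for x
    using assms(2)[OF that] compactin_subset_topspace[OF assms(1)] that
    by (auto simp: nonwandering_def wandering_def)
  then have "H \<subseteq> \<Union>{U. wandering U}"
    by blast
  moreover have "\<forall>U\<in>{U. wandering U}. openin X U"
    by (auto simp: wandering_def)
  ultimately obtain \<F> where \<F>: "finite \<F>" "\<F> \<subseteq> {U. wandering U}" "H \<subseteq> \<Union>\<F>"
    using assms(1) unfolding compactin_def by meson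
  have visits: "finite {n. (T ^^ n) x \<in> U}" if "wandering U" for U x
  proof -
    have "\<not> i < j" if "(T ^^ i) x \<in> U" "(T ^^ j) x \<in> U" for i j
    proof
      assume "i < j"
      then have "(T ^^ (j - i)) ((T ^^ i) x) = (T ^^ j) x"
        using funpow_add[of "j - i" i T] by simp
      moreover have "1 \<le> j - i"
        using \<open>i < j\<close> by simp
      ultimately show False
        using that \<open>wandering U\<close> unfolding wandering_def by metis
    qed
    then have "{n. (T ^^ n) x \<in> U} \<subseteq> {i}" if "(T ^^ i) x \<in> U" for i
      using that by (auto intro: linorder_neqE_nat)
    then show ?thesis
      by (metis (mono_tags, lifting) Collect_empty_eq finite.emptyI finite_insert finite_subset)
  qed
  have "\<exists>N. \<forall>n\<ge>N. (T ^^ n) x \<notin> \<Union>\<F>" for x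
  proof -
    have "finite (\<Union>U\<in>\<F>. {n. (T ^^ n) x \<in> U})"
      using \<F> visits by blast
    then obtain N where "\<forall>n\<in>(\<Union>U\<in>\<F>. {n. (T ^^ n) x \<in> U}). n < N"
      using finite_nat_set_iff_bounded by blast
    then have "(T ^^ n) x \<notin> \<Union>\<F>" if "n \<ge> N" for n
      using that by fastforce
    then show ?thesis by blast
  qed
  moreover have "openin X (\<Union>\<F>)"
    using \<F>(2) by (auto simp: wandering_def)
  ultimately show thesis
    using that \<F>(3) by blast
qed

text \<open>Continuity is assumed on \<open>K\<close> only, so the iterates are not treated as
  continuous maps of \<open>X\<close>. Instead the conditions are imposed one time step after
  another: the set for times up to \<open>Suc k\<close> is the preimage of the set for
  \<open>k\<close> under the restriction of \<open>T\<close> to \<open>K\<close>.\<close>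

lemma closedin_forward_invariant_core:
  assumes K: "closedin X K" and T: "continuous_map (subtopology X K) X T"
  shows "closedin X {x. \<forall>n. (T ^^ n) x \<in> K}"
proof -
  have "closedin X {x. \<forall>n\<le>k. (T ^^ n) x \<in> K}" for k
  proof (induction k)
    case 0
    then show ?case using K by simp
  next
    case (Suc k)
    have "{x. \<forall>n\<le>Suc k. (T ^^ n) x \<in> K} = {x \<in> topspace (subtopology X K). T x \<in> {x. \<forall>n\<le>k. (T ^^ n) x \<in> K}}"
      (is "?L = ?R")
    proof (intro set_eqI iffI)
      fix x assume x: "x \<in> ?L"
      have "(T ^^ n) (T x) \<in> K" if "n \<le> k" for n
        using x that by (auto simp: funpow_swap1 dest!: spec[of _ "Suc n"])
      moreover have "x \<in> K"
        using x by force
      ultimately show "x \<in> ?R"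
        using closedin_subset[OF K] by auto
    next
      fix x assume x: "x \<in> ?R"
      have "(T ^^ n) x \<in> K" if "n \<le> Suc k" for n
        using x that by (cases n) (auto simp: funpow_Suc_right simp del: funpow.simps(2))
      then show "x \<in> ?L" by blast
    qed
    moreover have "closedin X ?R"
      using closedin_continuous_map_preimage[OF T Suc.IH] K by (rule closedin_trans_full)
    ultimately show ?case by (simp only:)
  qed
  moreover have "{x. \<forall>n. (T ^^ n) x \<in> K} = (\<Inter>k. {x. \<forall>n\<le>k. (T ^^ n) x \<in> K})"
    by auto
  ultimately show ?thesis by auto
qed

text \<open>An invariant measure on the closed core \<open>Y\<close> is pushed forward to the whole
  space by the inclusion. What \<open>T\<close> does outside \<open>Y\<close> concerns a null set,
  all of whose subsets are measurable for the completion.\<close>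

lemma invariant_measure_if_discontinuities_wander:
  assumes "compact_space X" "metrizable_space X" "topspace X \<noteq> {}"
    and W: "openin X W" and T: "continuous_map (subtopology X W) X T"
    and T_space: "T \<in> topspace X \<rightarrow> topspace X"
    and wander: "\<And>x. x \<in> topspace X - W \<Longrightarrow> \<not> nonwandering X (topspace X) T x"
  shows "\<exists>\<mu>. invariant_borel_probability X (topspace X) T \<mu>"
proof -
  have "compactin X (topspace X - W)"
    using assms(1) W by (intro closedin_compact_space) auto
  then obtain U where U: "openin X U" "topspace X - W \<subseteq> U" "\<And>x. \<exists>N. \<forall>n\<ge>N. (T ^^ n) x \<notin> U"
    using wander by (rule orbit_eventually_avoids) auto
  define K where "K = topspace X - U"
  define Y where "Y = {x. \<forall>n. (T ^^ n) x \<in> K}"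
  have K: "closedin X K" "K \<subseteq> W"
    using U by (auto simp: K_def)
  have contK: "continuous_map (subtopology X K) X T"
    using T K(2) continuous_map_from_subtopology_mono by blast
  have Y: "closedin X Y"
    unfolding Y_def using K(1) contK by (rule closedin_forward_invariant_core)
  have Y_K: "Y \<subseteq> K"
    by (auto simp: Y_def dest: spec[of _ 0])
  have Y_space: "Y \<subseteq> topspace X"
    using Y by (rule closedin_subset)
  have T_Y: "T x \<in> Y" if "x \<in> Y" for x
    using that by (auto simp: Y_def funpow_swap1 dest: spec[of _ "Suc n" for n])
  \<comment> \<open>The witness is \<open>(T ^^ N) x\<close>, for a time \<open>N\<close> after
    which the orbit of \<open>x\<close> no longer meets \<open>U\<close>.\<close>
  have "Y \<noteq> {}"
  proof -
    obtain x where x: "x \<in> topspace X"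
      using assms(3) by blast
    obtain N where N: "\<And>n. n \<ge> N \<Longrightarrow> (T ^^ n) x \<notin> U"
      using U(3) by blast
    have "(T ^^ n) x \<in> topspace X" for n
      by (induction n) (use x T_space in auto)
    then have "(T ^^ (n + N)) x \<in> K" for n
      using N[of "n + N"] by (simp add: K_def)
    then have "(T ^^ n) ((T ^^ N) x) \<in> K" for n
      by (simp add: funpow_add)
    then show ?thesis
      unfolding Y_def by blast
  qed
  let ?Z = "subtopology X Y"
  have Z: "topspace ?Z = Y"
    using Y_space by (simp add: Int_absorb1)
  have "continuous_map ?Z ?Z T"
    using contK Y_K T_Y Y_space
    by (auto simp: continuous_map_in_subtopology intro: continuous_map_from_subtopology_mono)
  moreover have "compact_space ?Z"
    using assms(1) Y by (simp add: closedin_compact_space compact_space_subtopology)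
  ultimately obtain \<nu> where \<nu>: "prob_space \<nu>" "space \<nu> = Y" "sets \<nu> = sets (borel_on ?Z Y)"
    "T \<in> measurable \<nu> \<nu>" "distr \<nu> \<nu> T = \<nu>"
    using krylov_bogolyubov[of ?Z T] metrizable_space_subtopology[OF assms(2)] \<open>Y \<noteq> {}\<close> unfolding Z by metis
  let ?B = "borel_on X (topspace X)"
  have sub: "A \<in> sets ?B" if "A \<in> sets \<nu>" for A
    using that sets_borel_on_closed_subspace[OF Y] by (simp add: \<nu>(3))
  have Y_sets: "Y \<in> sets ?B"
    using sub[OF sets.top] by (simp add: \<nu>(2))
  \<comment> \<open>This makes the inclusion of \<open>Y\<close> into the whole space
    measurable.\<close>
  have trace: "A \<inter> Y \<in> sets \<nu>" if "A \<in> sets ?B" for A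
  proof -
    have "A \<in> sigma_sets (topspace X) {U. openin X U}"
      using that by (simp add: sets_borel_on_topspace)
    then have "(\<lambda>x. x) -` A \<inter> Y \<in> sigma_sets Y {(\<lambda>x. x) -` A \<inter> Y | A. A \<in> {U. openin X U}}"
      using sigma_sets_vimage_commute[of "\<lambda>x. x" Y "topspace X" "{U. openin X U}"] Y_space by blast
    also have "{(\<lambda>x. x) -` A \<inter> Y | A. A \<in> {U. openin X U}} = {U. openin ?Z U}"
      by (auto simp: openin_subtopology)
    finally show ?thesis
      using sets_borel_on_topspace[of ?Z] unfolding Z by (simp add: \<nu>(3))
  qed
  have id_meas: "(\<lambda>x. x) \<in> measurable \<nu> ?B"
    using Y_space trace by (auto intro!: measurableI simp: \<nu>(2))
  define \<mu> where "\<mu> = distr \<nu> ?B (\<lambda>x. x)"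
  have sets_\<mu>: "sets \<mu> = sets ?B" and space_\<mu>: "space \<mu> = topspace X"
    by (simp_all add: \<mu>_def)
  have em: "emeasure \<mu> A = emeasure \<nu> (A \<inter> Y)" if "A \<in> sets ?B" for A
    using that id_meas by (simp add: \<mu>_def emeasure_distr \<nu>(2))
  have null: "topspace X - Y \<in> null_sets \<mu>"
    using sets.compl_sets[OF Y_sets] em[of "topspace X - Y"] by (simp add: null_sets_def sets_\<mu> Int_commute)
  have "T -` A \<inter> topspace X \<in> sets (completion \<mu>) \<and>
    emeasure (completion \<mu>) (T -` A \<inter> topspace X) = emeasure \<mu> A" if "A \<in> sets \<mu>" for A
  proof -
    \<comment> \<open>Since \<open>T\<close> maps \<open>Y\<close> into itself, invariance of
      \<open>\<nu>\<close> gives the measure of \<open>?S\<close>. The set \<open>?N\<close> may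
      fail to be Borel, but it lies in the null set \<open>topspace X - Y\<close>.\<close>
    let ?S = "T -` (A \<inter> Y) \<inter> Y" and ?N = "T -` A \<inter> (topspace X - Y)"
    have A: "A \<in> sets ?B"
      using that by (simp add: sets_\<mu>)
    have S: "?S \<in> sets \<nu>"
      using measurable_sets[OF \<nu>(4) trace[OF A]] by (simp add: \<nu>(2))
    have N: "?N \<in> null_sets (completion \<mu>)"
      using null unfolding null_sets_completion_iff2 by blast
    have split: "T -` A \<inter> topspace X = ?S \<union> ?N"
      using T_Y Y_space by auto
    have S_\<mu>: "?S \<in> sets \<mu>"
      using sub[OF S] by (simp add: sets_\<mu>)
    have "emeasure (completion \<mu>) (?S \<union> ?N) = emeasure (completion \<mu>) ?S"
      using N S_\<mu> by (intro emeasure_Un_null_set) auto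
    also have "\<dots> = emeasure \<nu> ?S"
      using S_\<mu> em[OF sub[OF S]] by (simp add: main_part_sets Int_assoc)
    also have "\<dots> = emeasure (distr \<nu> \<nu> T) (A \<inter> Y)"
      using \<nu>(4) trace[OF A] by (simp add: emeasure_distr \<nu>(2))
    also have "\<dots> = emeasure \<mu> A"
      using em[OF A] by (simp add: \<nu>(5))
    finally show ?thesis
      using S_\<mu> N unfolding split by auto
  qed
  moreover have "prob_space \<mu>"
    unfolding \<mu>_def using \<nu>(1) id_meas by (rule prob_space.prob_space_distr)
  ultimately show ?thesis
    unfolding invariant_borel_probability_def using sets_\<mu> space_\<mu> by blast
qed

text \<open>A point of \<open>M\<close> outside all domains lies in the closure of one of them but
  not in that open domain, hence on its frontier and in the discontinuity set. So the union of the
  domains can serve as the open set on which \<open>T\<close> is continuous.\<close>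

lemma invariant_measure_of_piecewise_continuous:
  assumes "compact_space (subtopology X M)" "metrizable_space (subtopology X M)"
    and dd: "domain_decomposition X M n D" and pc: "piecewise_continuous X M n D T"
    and wander: "\<And>x. x \<in> discontinuity_set X n D \<Longrightarrow> \<not> nonwandering X M T x"
  shows "\<exists>\<mu>. invariant_borel_probability X M T \<mu>"
proof -
  let ?Z = "subtopology X M" and ?W = "\<Union>j\<in>{1..n}. D j"
  have D: "openin X (D j)" "D j \<noteq> {}" if "j \<in> {1..n}" for j
    using dd that by (auto simp: domain_decomposition_def is_domain_def)
  have M: "M = (\<Union>j\<in>{1..n}. X closure_of D j)" and "n \<ge> 1"
    using dd by (auto simp: domain_decomposition_def)
  have D_M: "D j \<subseteq> M" if "j \<in> {1..n}" for j
    using closure_of_subset[OF openin_subset[OF D(1)[OF that]]] that unfolding M by blast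
  have Z: "topspace ?Z = M"
    unfolding M using closure_of_subset_topspace by fastforce
  \<comment> \<open>\<open>nonwandering\<close> and \<open>borel_on\<close> depend on
    \<open>X\<close> only through \<open>subtopology X M\<close>, so this identity transfers
    hypothesis and conclusion between \<open>X\<close> and \<open>?Z\<close>.\<close>
  have Z_M: "subtopology ?Z M = ?Z"
    by (simp add: subtopology_subtopology)
  have "\<exists>\<mu>. invariant_borel_probability ?Z (topspace ?Z) T \<mu>"
  proof (rule invariant_measure_if_discontinuities_wander[where W = ?W])
    show "topspace ?Z \<noteq> {}"
      using D(2)[of 1] D_M[of 1] \<open>n \<ge> 1\<close> unfolding Z by force
    have W_open: "openin X ?W"
      using D by blast
    have W_M: "?W \<subseteq> M"
      using D_M by blast
    show "openin ?Z ?W"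
      using W_open W_M by (metis inf.absorb1 openin_subtopology)
    show "T \<in> topspace ?Z \<rightarrow> topspace ?Z"
      using pc unfolding Z by (simp add: piecewise_continuous_def)
    show "\<not> nonwandering ?Z (topspace ?Z) T x" if x: "x \<in> topspace ?Z - ?W" for x
    proof -
      obtain j where j: "j \<in> {1..n}" "x \<in> X closure_of D j" "x \<notin> D j"
      proof -
        have "x \<in> (\<Union>j\<in>{1..n}. X closure_of D j)" "x \<notin> ?W"
          using x M unfolding Z by auto
        then show thesis
          using that by blast
      qed
      then have "x \<in> discontinuity_set X n D"
        using D(1)[OF j(1)] by (auto simp: discontinuity_set_def frontier_of_def interior_of_openin)
      from wander[OF this] show ?thesis
        unfolding nonwandering_def Z Z_M .
    qed
    have cont: "continuous_map (subtopology X (D j)) ?Z T" if "j \<in> {1..n}" for j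
      using pc that by (simp add: piecewise_continuous_def)
    show "continuous_map (subtopology ?Z ?W) ?Z T"
    proof -
      have sub: "subtopology ?Z ?W = subtopology X ?W"
        using W_M by (simp add: subtopology_subtopology Int_absorb1)
      show ?thesis
        unfolding sub
      \<comment> \<open>The domains are open, so continuity on each gives continuity on the union.
        All pieces are restrictions of the one map \<open>T\<close>, hence agree on
        overlaps.\<close>
      proof (rule pasting_lemma[where T = D and I = "{1..n}" and f = "\<lambda>_. T"])
        fix j assume j: "j \<in> {1..n}"
        show "openin (subtopology X ?W) (D j)"
          using D(1)[OF j] j W_open by (auto simp: openin_open_subtopology)
        show "continuous_map (subtopology (subtopology X ?W) (D j)) ?Z T"
          using cont[OF j] j by (simp add: subtopology_subtopology Int_absorb1 UN_upper)
      qed (auto simp: topspace_subtopology)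
    qed
  qed (use assms in auto)
  then show ?thesis
    by (simp only: invariant_borel_probability_def borel_on_def Z Z_M)
qed

theorem corollary3p3:
  "(\<forall>(M :: 'a set) d (\<A> :: ('a, 'e::euclidean_space) chart set) g n D T.
      compact_riemannian_manifold M d \<A> g \<and>
      domain_decomposition (Metric_space.mtopology M d) M n D \<and>
      piecewise_continuous (Metric_space.mtopology M d) M n D T \<and>
      (\<forall>x\<in>discontinuity_set (Metric_space.mtopology M d) n D.
         \<not> nonwandering (Metric_space.mtopology M d) M T x) \<longrightarrow>
      (\<exists>\<mu>. invariant_borel_probability (Metric_space.mtopology M d) M T \<mu>))
   \<and>
   (\<forall>(M :: 'b::euclidean_space set) n D T.
      bounded M \<and>
      domain_decomposition euclidean M n D \<and>
      piecewise_continuous euclidean M n D T \<and>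
      (\<forall>x\<in>discontinuity_set euclidean n D. \<not> nonwandering euclidean M T x) \<longrightarrow>
      (\<exists>\<mu>. invariant_borel_probability euclidean M T \<mu>))"
proof (intro conjI allI impI; elim conjE)
  fix M :: "'a set" and d and \<A> :: "('a, 'e) chart set" and g n D T
  assume "compact_riemannian_manifold M d \<A> g"
  then interpret compact_riemannian_manifold M d \<A> g .
  assume "domain_decomposition mtopology M n D" "piecewise_continuous mtopology M n D T"
    "\<forall>x\<in>discontinuity_set mtopology n D. \<not> nonwandering mtopology M T x"
  \<comment> \<open>Here \<open>M\<close> is the whole space of \<open>mtopology\<close>, so the
    subspace on \<open>M\<close> is the compact metric space itself.\<close>
  then show "\<exists>\<mu>. invariant_borel_probability mtopology M T \<mu>"
    using compact metrizable_space_mtopology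
    by (intro invariant_measure_of_piecewise_continuous metrizable_space_subtopology)
      (auto simp: subtopology_topspace[of mtopology, simplified])
next
  fix M :: "'b set" and n D T
  assume "bounded M" and dd: "domain_decomposition euclidean M n D"
    and "piecewise_continuous euclidean M n D T"
    "\<forall>x\<in>discontinuity_set euclidean n D. \<not> nonwandering euclidean M T x"
  \<comment> \<open>A finite union of closures is closed; with boundedness, Heine-Borel makes
    \<open>M\<close> compact.\<close>
  moreover have "closed M"
    using dd by (auto simp: domain_decomposition_def)
  ultimately show "\<exists>\<mu>. invariant_borel_probability euclidean M T \<mu>"
    by (intro invariant_measure_of_piecewise_continuous metrizable_space_subtopology metrizable_space_euclidean)
      (auto simp: compact_space_subtopology compact_eq_bounded_closed)
qed

end
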